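(* Let $N\ge 1$, let $I_1,\dots,I_{N+1}$ be positive integers, let $\mathcal{W}\in\mathbb{R}^{I_1\times\cdots\times I_N\times I_{N+1}}$ be a real tensor, and let $f:\mathbb{R}^{I_1\times\cdots\times I_N}\to\mathbb{R}^{I_{N+1}}$ be the linear map defined by $f(\mathcal{X})=\mathcal{W}_{(N+1)}\,\mathrm{vec}(\mathcal{X})$. Then the following hold: (i) if $\mathcal{W}$ admits a tensor train (TT) decomposition of rank $(1,R_1,\dots,R_N,1)$, then $\dim(\mathrm{Im}(f))\le R_N$; (ii) if $\mathcal{W}$ admits a Tucker decomposition of rank $(R_1,R_2,\dots,R_{N+1})$, then $\dim(\mathrm{Im}(f))\le R_{N+1}$; (iii) if $\mathcal{W}$ admits a CP decomposition of rank $R$, then $\dim(\mathrm{Im}(f))\le R$.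
   Context: All tensors are real and indexed by $i_k\in\{1,\dots,I_k\}$. Matricization and vectorization: $\mathcal{W}_{(N+1)}\in\mathbb{R}^{I_{N+1}\times I_1\cdots I_N}$ is the mode-$(N+1)$ unfolding of $\mathcal{W}$, the matrix whose columns are the mode-$(N+1)$ fibers of $\mathcal{W}$ (vectors obtained by fixing all indices but the last), the columns being ordered consistently with $\mathrm{vec}(\mathcal{X})\in\mathbb{R}^{I_1\cdots I_N}$, the vectorization of $\mathcal{X}$. Thus, entrywise, $f(\mathcal{X})_{i_{N+1}}=\sum_{i_1,\dots,i_N}\mathcal{W}_{i_1,\dots,i_N,i_{N+1}}\,\mathcal{X}_{i_1,\dots,i_N}$. "Admits a decomposition" means that the following equalities hold exactly: TT decomposition of rank $(1,R_1,\dots,R_N,1)$: with $R_0=R_{N+1}=1$, there are core tensors $\mathcal{G}^{(k)}\in\mathbb{R}^{R_{k-1}\times I_k\times R_k}$, $k=1,\dots,N+1$, such that for all indices $\mathcal{W}_{i_1,\dots,i_{N+1}}=\mathbf{G}^{(1)}_{:,i_1,:}\,\mathbf{G}^{(2)}_{:,i_2,:}\cdots\mathbf{G}^{(N+1)}_{:,i_{N+1},:}$ (a product of matrices of sizes $R_{k-1}\times R_k$, giving a $1\times 1$ matrix identified with a scalar). Tucker decomposition of rank $(R_1,\dots,R_{N+1})$: there are a core tensor $\mathcal{G}\in\mathbb{R}^{R_1\times\cdots\times R_{N+1}}$ and matrices $\mathbf{U}^{(k)}\in\mathbb{R}^{I_k\times R_k}$, $k=1,\dots,N+1$, such that $\mathcal{W}=\mathcal{G}\times_1\mathbf{U}^{(1)}\times_2\cdots\times_{N+1}\mathbf{U}^{(N+1)}$,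 i.e. $\mathcal{W}_{i_1,\dots,i_{N+1}}=\sum_{r_1=1}^{R_1}\cdots\sum_{r_{N+1}=1}^{R_{N+1}}\mathcal{G}_{r_1,\dots,r_{N+1}}\prod_{k=1}^{N+1}\mathbf{U}^{(k)}_{i_k,r_k}$. CP decomposition of rank $R$: there are vectors $\mathbf{a}^{(j)}_k\in\mathbb{R}^{I_k}$ for $j=1,\dots,R$ and $k=1,\dots,N+1$ such that $\mathcal{W}=\sum_{j=1}^R\mathbf{a}^{(j)}_1\circ\cdots\circ\mathbf{a}^{(j)}_{N+1}$, where $\circ$ is the outer product, i.e. $\mathcal{W}_{i_1,\dots,i_{N+1}}=\sum_{j=1}^R\prod_{k=1}^{N+1}(\mathbf{a}^{(j)}_k)_{i_k}$. In each case the rank is the size parameter of the given decomposition; no minimality is assumed. *)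

theory Defs
  imports "Jordan_Normal_Form.VS_Connect" "HOL-Library.FuncSet"
begin

text \<open>
  A real tensor of shape \<open>I = [I\<^sub>1, \<dots>, I\<^sub>n]\<close> is a function on multi-indices, which are lists of length
  \<open>n\<close>; indices are counted from 0. Values outside the index set are fixed to \<open>undefined\<close>.
\<close>

definition index_set :: "nat list \<Rightarrow> nat list set" where
  "index_set I = {ix. list_all2 (<) ix I}"

definition tensors :: "nat list \<Rightarrow> (nat list \<Rightarrow> real) set" where
  "tensors I = (index_set I \<rightarrow>\<^sub>E UNIV)"

text \<open>
  The order of the multi-indices that vectorization and unfolding share
  (lexicographic; any common order gives the same map).
\<close>

definition index_list :: "nat list \<Rightarrow> nat list list" where
  "index_list I = product_lists (map (upt 0) I)"

lemma set_index_list: "set (index_list I) = index_set I"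
  by (auto simp: index_list_def index_set_def product_lists_set list_all2_map2)

lemma distinct_index_list: "distinct (index_list I)"
  by (auto simp: index_list_def intro!: distinct_product_lists)

definition vectorize :: "nat list \<Rightarrow> (nat list \<Rightarrow> real) \<Rightarrow> real vec" where
  "vectorize I X = vec_of_list (map X (index_list I))"

definition last_mode_fiber :: "nat list \<Rightarrow> (nat list \<Rightarrow> real) \<Rightarrow> nat list \<Rightarrow> real vec" where
  "last_mode_fiber I W ix = vec (last I) (\<lambda>i. W (ix @ [i]))"

definition last_mode_unfolding :: "nat list \<Rightarrow> (nat list \<Rightarrow> real) \<Rightarrow> real mat" where
  "last_mode_unfolding I W =
     mat_of_cols (last I) (map (last_mode_fiber I W) (index_list (butlast I)))"

definition tensor_map :: "nat list \<Rightarrow> (nat list \<Rightarrow> real) \<Rightarrow> (nat list \<Rightarrow> real) \<Rightarrow> real vec" where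
  "tensor_map I W X = last_mode_unfolding I W *\<^sub>v vectorize (butlast I) X"

definition tensor_map_image :: "nat list \<Rightarrow> (nat list \<Rightarrow> real) \<Rightarrow> real vec set" where
  "tensor_map_image I W = tensor_map I W ` tensors (butlast I)"

text \<open>
  \<open>subspace_dim n S\<close> is meaningful when \<open>S\<close> is a linear subspace of \<open>\<real>\<^sup>n\<close>;
  for images of tensor maps see \<open>subspace_tensor_map_image\<close> below.
\<close>

definition subspace_dim :: "nat \<Rightarrow> real vec set \<Rightarrow> nat" where
  "subspace_dim n S = vectorspace.dim class_ring ((module_vec TYPE(real) n)\<lparr>carrier := S\<rparr>)"

text \<open>
  In the following, modes, core tensors and factor matrices are counted from 0 as well.
  In \<open>admits_TT I R W\<close>, the list \<open>R\<close> is the full rank \<open>[R\<^sub>0, \<dots>, R\<^sub>n]\<close>, including both boundary ones.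
\<close>

definition core_slice :: "nat \<Rightarrow> nat \<Rightarrow> (nat list \<Rightarrow> real) \<Rightarrow> nat \<Rightarrow> real mat" where
  "core_slice a b G i = mat a b (\<lambda>(p, q). G [p, i, q])"

definition admits_TT :: "nat list \<Rightarrow> nat list \<Rightarrow> (nat list \<Rightarrow> real) \<Rightarrow> bool" where
  "admits_TT I R W \<longleftrightarrow>
     length R = length I + 1 \<and> hd R = 1 \<and> last R = 1 \<and>
     (\<exists>G :: nat \<Rightarrow> nat list \<Rightarrow> real.
        (\<forall>k<length I. G k \<in> tensors [R ! k, I ! k, R ! (k + 1)]) \<and>
        (\<forall>ix\<in>index_set I.
           W ix = foldr (*) (map (\<lambda>k. core_slice (R ! k) (R ! (k + 1)) (G k) (ix ! k)) [0..<length I])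
                    (1\<^sub>m 1) $$ (0, 0)))"

definition admits_Tucker :: "nat list \<Rightarrow> nat list \<Rightarrow> (nat list \<Rightarrow> real) \<Rightarrow> bool" where
  "admits_Tucker I R W \<longleftrightarrow>
     length R = length I \<and>
     (\<exists>G\<in>tensors R. \<exists>U :: nat \<Rightarrow> real mat.
        (\<forall>k<length I. U k \<in> carrier_mat (I ! k) (R ! k)) \<and>
        (\<forall>ix\<in>index_set I.
           W ix = (\<Sum>r\<in>index_set R. G r * (\<Prod>k<length I. U k $$ (ix ! k, r ! k)))))"

definition admits_CP :: "nat list \<Rightarrow> nat \<Rightarrow> (nat list \<Rightarrow> real) \<Rightarrow> bool" where
  "admits_CP I R W \<longleftrightarrow>
     (\<exists>a :: nat \<Rightarrow> nat \<Rightarrow> real vec.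
        (\<forall>j<R. \<forall>k<length I. a j k \<in> carrier_vec (I ! k)) \<and>
        (\<forall>ix\<in>index_set I. W ix = (\<Sum>j<R. \<Prod>k<length I. a j k $ (ix ! k))))"

lemma tensor_map_carrier: "tensor_map I W X \<in> carrier_vec (last I)"
  by (rule carrier_vecI) (simp add: tensor_map_def last_mode_unfolding_def)

lemma tensor_map_entry:
  assumes "i < last I"
  shows "tensor_map I W X $ i = (\<Sum>ix\<in>index_set (butlast I). W (ix @ [i]) * X ix)"
proof -
  let ?L = "index_list (butlast I)"
  have "tensor_map I W X $ i = (\<Sum>j<length ?L. W (?L ! j @ [i]) * X (?L ! j))"
    using assms
    by (auto simp: tensor_map_def last_mode_unfolding_def last_mode_fiber_def vectorize_def
        scalar_prod_def mat_of_cols_index vec_of_list_index lessThan_atLeast0 intro!: sum.cong)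
  also have "\<dots> = (\<Sum>ix\<leftarrow>?L. W (ix @ [i]) * X ix)"
    by (simp add: sum_list_sum_nth lessThan_atLeast0)
  also have "\<dots> = (\<Sum>ix\<in>set ?L. W (ix @ [i]) * X ix)"
    by (rule sum_list_distinct_conv_sum_set[OF distinct_index_list])
  finally show ?thesis
    by (simp add: set_index_list)
qed

lemma tensor_map_linear:
  assumes "\<And>ix. ix \<in> index_set (butlast I) \<Longrightarrow> Z ix = a * X ix + b * Y ix"
  shows "tensor_map I W Z = a \<cdot>\<^sub>v tensor_map I W X + b \<cdot>\<^sub>v tensor_map I W Y"
proof (rule eq_vecI)
  note [simp] = carrier_vecD[OF tensor_map_carrier]
  show "dim_vec (tensor_map I W Z) = dim_vec (a \<cdot>\<^sub>v tensor_map I W X + b \<cdot>\<^sub>v tensor_map I W Y)"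
    by simp
  fix i assume "i < dim_vec (a \<cdot>\<^sub>v tensor_map I W X + b \<cdot>\<^sub>v tensor_map I W Y)"
  then have i: "i < last I" by simp
  have "tensor_map I W Z $ i =
      (\<Sum>ix\<in>index_set (butlast I). a * (W (ix @ [i]) * X ix) + b * (W (ix @ [i]) * Y ix))"
    unfolding tensor_map_entry[OF i] by (rule sum.cong[OF refl]) (simp add: assms algebra_simps)
  also have "\<dots> = a * tensor_map I W X $ i + b * tensor_map I W Y $ i"
    unfolding tensor_map_entry[OF i] by (simp only: sum.distrib sum_distrib_left)
  finally show "tensor_map I W Z $ i = (a \<cdot>\<^sub>v tensor_map I W X + b \<cdot>\<^sub>v tensor_map I W Y) $ i"
    using i by simp
qed

lemma subspace_tensor_map_image:
  "subspace class_ring (tensor_map_image I W) (module_vec TYPE(real) (last I))"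
proof -
  interpret vec_space "TYPE(real)" "last I" .
  let ?S = "tensor_map_image I W"
  have comb: "a \<cdot>\<^sub>v v + b \<cdot>\<^sub>v w \<in> ?S" if v: "v \<in> ?S" and w: "w \<in> ?S" for a b v w
  proof -
    obtain X Y where "v = tensor_map I W X" "w = tensor_map I W Y"
      using v w by (auto simp: tensor_map_image_def)
    moreover define Z where "Z = (\<lambda>ix\<in>index_set (butlast I). a * X ix + b * Y ix)"
    ultimately have "tensor_map I W Z = a \<cdot>\<^sub>v v + b \<cdot>\<^sub>v w"
      by (simp add: tensor_map_linear)
    moreover have "Z \<in> tensors (butlast I)"
      by (auto simp: Z_def tensors_def)
    ultimately show ?thesis
      by (metis tensor_map_image_def imageI)
  qed
  have sub: "?S \<subseteq> carrier_vec (last I)"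
    by (auto simp: tensor_map_image_def intro: tensor_map_carrier)
  have "restrict (\<lambda>_. 0) (index_set (butlast I)) \<in> tensors (butlast I)"
    by (auto simp: tensors_def)
  then have ne: "?S \<noteq> {}"
    by (auto simp: tensor_map_image_def)
  have add: "v + w \<in> ?S" if "v \<in> ?S" "w \<in> ?S" for v w
    using comb[OF that, of 1 1] by simp
  have smult: "a \<cdot>\<^sub>v v \<in> ?S" if v: "v \<in> ?S" for a v
  proof -
    have "v \<in> carrier_vec (last I)" using v sub by auto
    then show ?thesis using comb[OF v v, of a 0] by simp
  qed
  obtain v where v: "v \<in> ?S" using ne by auto
  then have "0\<^sub>v (last I) \<in> ?S"
    using smult[OF v, of 0] subsetD[OF sub v] by (metis lmult_0)
  then have "submodule class_ring ?S V"
    using sub add smult module_axioms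
    by (intro submodule.intro) (simp_all add: module_vec_simps)
  then show ?thesis
    using vectorspace_axioms by (simp add: subspace_def)
qed

end

theory Submission
  imports Defs "Jordan_Normal_Form.DL_Rank"
begin

text \<open>
  The dimension of the image of \<open>f\<close> is the rank of the last-mode unfolding. Each of the three
  decompositions separates the last index from the others along a single bond of size \<open>R\<close>,
  \<open>W (ix @ [i]) = (\<Sum>r<R. B i r * C r ix)\<close>, so the unfolding factors through \<open>\<real>\<^sup>R\<close>.
\<close>

text \<open>Each column of \<open>A * B\<close> is \<open>A\<close> applied to a column of
  \<open>B\<close>, so it lies in the column space of \<open>A\<close>, which is spanned by
  \<open>r\<close> columns.\<close>

lemma (in vec_space) rank_mult_le:
  assumes A: "A \<in> carrier_mat n r" and B: "B \<in> carrier_mat r nc"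
  shows "rank (A * B) \<le> r"
proof -
  let ?SA = "span (set (cols A))" and ?SAB = "span (set (cols (A * B)))"
  have AB: "A * B \<in> carrier_mat n nc"
    using A B by simp
  have colsA: "set (cols A) \<subseteq> carrier_vec n" and colsAB: "set (cols (A * B)) \<subseteq> carrier_vec n"
    using cols_dim[of A] cols_dim[of "A * B"] A by auto
  have "set (cols (A * B)) \<subseteq> ?SA"
  proof
    fix v assume "v \<in> set (cols (A * B))"
    then obtain j where "j < nc" "v = A *\<^sub>v col B j"
      using AB col_mult2[OF A B] by (metis carrier_matD(2) cols_length cols_nth in_set_conv_nth)
    then have "v \<in> col_space A"
      using A B by (auto simp: col_space_eq[OF A])
    then show "v \<in> ?SA"
      by (simp add: col_space_def)
  qed
  then have le: "?SAB \<subseteq> ?SA"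
    using colsA by (metis span_is_monotone span_span)
  have subA: "subspace class_ring ?SA V" and subAB: "subspace class_ring ?SAB V"
    using colsA colsAB by (auto intro!: span_is_subspace)
  \<comment> \<open>The span of the columns of \<open>A\<close> is taken as a finite-dimensional
    space in its own right, with the smaller span as a subspace of it.\<close>
  have "rank (A * B) \<le> rank A"
    using vectorspace.subspace_dim[OF subspace_is_vs[OF subA] nested_subspaces[OF subA subAB le]
        fin_dim_span_cols[OF A]] fin_dim_span_cols[OF AB]
    by (simp add: rank_def)
  also have "\<dots> \<le> r"
    by (rule rank_le_nc[OF A])
  finally show ?thesis .
qed

lemma vectorize_surj:
  assumes "v \<in> carrier_vec (length (index_list I))"
  shows "\<exists>X\<in>tensors I. vectorize I X = v"
proof
  let ?L = "index_list I"
  \<comment> \<open>The entry at \<open>ix\<close> is read off at the position of \<open>ix\<close>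
    in \<open>?L\<close>; that position is unique because \<open>?L\<close> is distinct.\<close>
  let ?X = "\<lambda>ix\<in>index_set I. v $ (inv_into {..<length ?L} ((!) ?L) ix)"
  show "?X \<in> tensors I"
    by (simp add: tensors_def)
  have "inj_on ((!) ?L) {..<length ?L}"
    by (rule inj_on_nth[OF distinct_index_list]) simp
  moreover have "?L ! j \<in> index_set I" if "j < length ?L" for j
    using that set_index_list nth_mem by blast
  ultimately show "vectorize I ?X = v"
    using assms by (intro eq_vecI) (auto simp: vectorize_def vec_of_list_index)
qed

lemma last_mode_unfolding_carrier:
  "last_mode_unfolding I W \<in> carrier_mat (last I) (length (index_list (butlast I)))"
  unfolding last_mode_unfolding_def by (metis length_map mat_of_cols_carrier(1))

text \<open>Vectorization reaches every coordinate vector, so the image is the whole column space of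
  the unfolding.\<close>

lemma subspace_dim_tensor_map_image:
  "subspace_dim (last I) (tensor_map_image I W) = vec_space.rank (last I) (last_mode_unfolding I W)"
proof -
  interpret vec_space "TYPE(real)" "last I" .
  let ?M = "last_mode_unfolding I W"
  note M = last_mode_unfolding_carrier[of I W]
  have dim: "vectorize (butlast I) X \<in> carrier_vec (length (index_list (butlast I)))" for X
    by (auto simp: vectorize_def intro!: carrier_vecI)
  have "tensor_map_image I W = col_space ?M"
    unfolding col_space_eq[OF M] tensor_map_image_def tensor_map_def
    using M dim vectorize_surj[of _ "butlast I"] by (fastforce simp: image_iff)
  then show ?thesis
    by (simp add: subspace_dim_def rank_def col_space_def)
qed

lemma subspace_dim_tensor_map_image_le:
  assumes "\<And>ix i. ix \<in> index_set (butlast I) \<Longrightarrow> i < last I \<Longrightarrow>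
    W (ix @ [i]) = (\<Sum>r<R. B i r * C r ix)"
  shows "subspace_dim (last I) (tensor_map_image I W) \<le> R"
proof -
  let ?L = "index_list (butlast I)"
  let ?B = "mat (last I) R (\<lambda>(i, r). B i r)" and ?C = "mat R (length ?L) (\<lambda>(r, j). C r (?L ! j))"
  have mem: "?L ! j \<in> index_set (butlast I)" if "j < length ?L" for j
    using that set_index_list nth_mem by blast
  have "last_mode_unfolding I W = ?B * ?C"
    by (rule eq_matI) (auto simp: last_mode_unfolding_def last_mode_fiber_def mat_of_cols_index
        scalar_prod_def assms[OF mem] lessThan_atLeast0)
  moreover have "vec_space.rank (last I) (?B * ?C) \<le> R"
    by (rule vec_space.rank_mult_le) auto
  ultimately show ?thesis
    by (simp add: subspace_dim_tensor_map_image)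
qed

lemma index_set_snoc:
  assumes "I \<noteq> []" "ix \<in> index_set (butlast I)" "i < last I"
  shows "ix @ [i] \<in> index_set I"
proof -
  have "list_all2 (<) (ix @ [i]) (butlast I @ [last I])"
    using assms by (intro list_all2_appendI) (auto simp: index_set_def)
  then show ?thesis
    using assms by (simp add: index_set_def)
qed

lemma length_index_set: "ix \<in> index_set I \<Longrightarrow> length ix = length I"
  by (auto simp: index_set_def dest: list_all2_lengthD)

lemma finite_index_set: "finite (index_set I)"
  by (metis set_index_list finite_set)

text \<open>Associativity moves the seed \<open>X\<close> out of the fold. It needs the dimensions
  of the partial products, so the carrier claim is proved in the same induction, which runs
  downwards in \<open>m\<close> because \<open>foldr\<close> peels factors off on the left.\<close>

lemma foldr_mult_mat:
  fixes A :: "nat \<Rightarrow> 'a :: semiring_1 mat"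
  assumes "m \<le> n" "\<And>k. k < n \<Longrightarrow> A k \<in> carrier_mat (d k) (d (Suc k))" "X \<in> carrier_mat (d n) c"
  shows "foldr (*) (map A [m..<n]) (1\<^sub>m (d n)) \<in> carrier_mat (d m) (d n) \<and>
    foldr (*) (map A [m..<n]) X = foldr (*) (map A [m..<n]) (1\<^sub>m (d n)) * X"
  using assms(1)
proof (induction m rule: inc_induct)
  case base
  then show ?case using assms(3) by simp
next
  case (step m)
  then have "A m \<in> carrier_mat (d m) (d (Suc m))"
    using assms(2) by simp
  then show ?case
    using step assms(3) by (auto simp: upt_conv_Cons assoc_mult_mat[of _ "d m" "d (Suc m)" _ "d n" X c])
qed

text \<open>The bond joins the last two cores: the first \<open>N\<close> slices multiply to a row
  vector that depends only on \<open>ix\<close>, and the last slice is a column that depends only on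
  \<open>i\<close>.\<close>

lemma admits_TT_subspace_dim_le:
  assumes I: "length I = N + 1" and R: "length R = N" "N \<ge> 1" and TT: "admits_TT I ([1] @ R @ [1]) W"
  shows "subspace_dim (last I) (tensor_map_image I W) \<le> R ! (N - 1)"
proof -
  let ?d = "\<lambda>k. ([1] @ R @ [1]) ! k"
  obtain G where G: "\<forall>ix\<in>index_set I. W ix =
      foldr (*) (map (\<lambda>k. core_slice (?d k) (?d (k + 1)) (G k) (ix ! k)) [0..<N + 1]) (1\<^sub>m 1) $$ (0, 0)"
    using TT unfolding admits_TT_def I by blast
  let ?A = "\<lambda>ix k. core_slice (?d k) (?d (Suc k)) (G k) (ix ! k)"
  define P where "P ix = foldr (*) (map (?A ix) [0..<N]) (1\<^sub>m (?d N))" for ix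
  \<comment> \<open>The leading 1 shifts the ranks by one, so the bond size \<open>?d N\<close> is
    the last entry of \<open>R\<close>.\<close>
  have d: "?d 0 = 1" "?d N = R ! (N - 1)" "?d (Suc N) = 1"
    using R by (auto simp: nth_append nth_Cons')
  have "W (ix @ [i]) = (\<Sum>r<R ! (N - 1). G N [r, i, 0] * P ix $$ (0, r))"
    if ix: "ix \<in> index_set (butlast I)" and i: "i < last I" for ix i
  proof -
    let ?X = "core_slice (R ! (N - 1)) 1 (G N) i"
    have len: "length ix = N"
      using length_index_set[OF ix] I by simp
    have I_ne: "I \<noteq> []" using I by auto
    have A: "?A ix k \<in> carrier_mat (?d k) (?d (Suc k))" for k
      by (simp add: core_slice_def)
    have X: "?X \<in> carrier_mat (?d N) 1"
      unfolding d by (simp add: core_slice_def)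
    have P: "P ix \<in> carrier_mat 1 (R ! (N - 1))"
      and PX: "foldr (*) (map (?A ix) [0..<N]) ?X = P ix * ?X"
      using foldr_mult_mat[of 0 N "?A ix" ?d ?X 1, OF _ A X] unfolding P_def d by auto
    \<comment> \<open>Splitting \<open>N\<close> off the end of the range makes the last slice,
      times the identity, the seed of the remaining fold.\<close>
    have "W (ix @ [i]) = foldr (*) (map (?A (ix @ [i])) [0..<N])
        (core_slice (?d N) (?d (Suc N)) (G N) ((ix @ [i]) ! N) * 1\<^sub>m 1) $$ (0, 0)"
      using bspec[OF G index_set_snoc[OF I_ne ix i]] by simp
    \<comment> \<open>As \<open>ix\<close> has length \<open>N\<close>, the first \<open>N\<close>
      slices never see the appended \<open>i\<close>.\<close>
    also have "map (?A (ix @ [i])) [0..<N] = map (?A ix) [0..<N]"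
      using len by (auto simp: nth_append)
    also have "core_slice (?d N) (?d (Suc N)) (G N) ((ix @ [i]) ! N) = ?X"
      unfolding d using len by (simp add: nth_append)
    also have "?X * 1\<^sub>m 1 = ?X"
      using X by simp
    also have "foldr (*) (map (?A ix) [0..<N]) ?X = P ix * ?X"
      by (rule PX)
    also have "(P ix * ?X) $$ (0, 0) = (\<Sum>r<R ! (N - 1). G N [r, i, 0] * P ix $$ (0, r))"
      using P by (simp add: scalar_prod_def core_slice_def lessThan_atLeast0 mult.commute)
    finally show ?thesis .
  qed
  then show ?thesis
    by (rule subspace_dim_tensor_map_image_le)
qed

text \<open>The bond is the last index of the core: \<open>U N\<close> sees only \<open>i\<close>
  and that index, and summing over the other core indices gives a factor free of
  \<open>i\<close>.\<close>

lemma admits_Tucker_subspace_dim_le: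
  assumes I: "length I = N + 1" and Tucker: "admits_Tucker I R W"
  shows "subspace_dim (last I) (tensor_map_image I W) \<le> R ! N"
proof -
  obtain G U where R: "length R = N + 1" and G: "\<forall>ix\<in>index_set I.
      W ix = (\<Sum>r\<in>index_set R. G r * (\<Prod>k<N + 1. U k $$ (ix ! k, r ! k)))"
    using Tucker unfolding admits_Tucker_def I by blast
  define C where "C q ix = (\<Sum>r\<in>{r \<in> index_set R. r ! N = q}. G r * (\<Prod>k<N. U k $$ (ix ! k, r ! k)))"
    for q ix
  have "W (ix @ [i]) = (\<Sum>q<R ! N. U N $$ (i, q) * C q ix)"
    if ix: "ix \<in> index_set (butlast I)" and i: "i < last I" for ix i
  proof -
    let ?g = "\<lambda>r. U N $$ (i, r ! N) * (G r * (\<Prod>k<N. U k $$ (ix ! k, r ! k)))"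
    have len: "length ix = N"
      using length_index_set[OF ix] I by simp
    have I_ne: "I \<noteq> []" using I by auto
    have "W (ix @ [i]) = (\<Sum>r\<in>index_set R. ?g r)"
      using len by (simp add: bspec[OF G index_set_snoc[OF I_ne ix i]] nth_append mult_ac)
    \<comment> \<open>The core indices are grouped by their last component \<open>q\<close>, which
      is below \<open>R ! N\<close> on \<open>index_set R\<close>.\<close>
    also have "\<dots> = (\<Sum>q<R ! N. \<Sum>r\<in>{r \<in> index_set R. r ! N = q}. ?g r)"
      using R by (intro sum.group[symmetric] finite_index_set)
        (auto simp: index_set_def list_all2_conv_all_nth)
    also have "\<dots> = (\<Sum>q<R ! N. U N $$ (i, q) * C q ix)"
      by (simp add: C_def sum_distrib_left)
    finally show ?thesis .
  qed
  then show ?thesis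
    by (rule subspace_dim_tensor_map_image_le)
qed

text \<open>The bond is the index \<open>j\<close> of the rank-one terms; in each term the factor of
  the last mode splits off.\<close>

lemma admits_CP_subspace_dim_le:
  assumes I: "length I = N + 1" and CP: "admits_CP I R W"
  shows "subspace_dim (last I) (tensor_map_image I W) \<le> R"
proof -
  obtain a where a: "\<And>ix. ix \<in> index_set I \<Longrightarrow> W ix = (\<Sum>j<R. \<Prod>k<N + 1. a j k $ (ix ! k))"
    using CP I unfolding admits_CP_def by metis
  have "W (ix @ [i]) = (\<Sum>j<R. a j N $ i * (\<Prod>k<N. a j k $ (ix ! k)))"
    if ix: "ix \<in> index_set (butlast I)" and i: "i < last I" for ix i
  proof -
    have len: "length ix = N"
      using length_index_set[OF ix] I by simp
    have I_ne: "I \<noteq> []" using I by auto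
    show ?thesis
      using len by (simp add: a[OF index_set_snoc[OF I_ne ix i]] nth_append mult.commute)
  qed
  then show ?thesis
    by (rule subspace_dim_tensor_map_image_le)
qed

theorem proposition2:
  fixes N :: nat and I :: "nat list" and W :: "nat list \<Rightarrow> real"
  assumes "N \<ge> 1"
    and "length I = N + 1"
    and "\<forall>d\<in>set I. d > 0"
    and "W \<in> tensors I"
  shows "(\<forall>R. length R = N \<and> admits_TT I ([1] @ R @ [1]) W \<longrightarrow>
            subspace_dim (last I) (tensor_map_image I W) \<le> R ! (N - 1))
       \<and> (\<forall>R. length R = N + 1 \<and> admits_Tucker I R W \<longrightarrow>
            subspace_dim (last I) (tensor_map_image I W) \<le> R ! N)
       \<and> (\<forall>R. admits_CP I R W \<longrightarrow>
            subspace_dim (last I) (tensor_map_image I W) \<le> R)"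
  using assms(1,2) admits_TT_subspace_dim_le admits_Tucker_subspace_dim_le admits_CP_subspace_dim_le
  by blast

end
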